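(* Let $\Omega\subset\mathbb{C}$ be a domain and let $H$ be a Hilbert space of analytic functions on $\Omega$ with nonsingular reproducing kernel. Suppose that $H$ is invariant under the operation $M_z$ of multiplication by the independent variable, and that every bounded linear operator on $H$ which commutes with $M_z$ is a multiplication operator (i.e. of the form $h\mapsto\theta h$ for some multiplier $\theta$ of $H$). Let $\phi:D_\phi\subset\Omega\to\mathbb{C}$ be a $1$-pseudomultiplier of $H$. Then there exist $\alpha\in\mathbb{C}$ and a multiplier $\theta$ of $H$ such that $D_\phi$ is either $\Omega$ or $\Omega\setminus\{\alpha\}$ and $$\phi(\lambda)=\frac{\theta(\lambda)}{\lambda-\alpha}\quad\text{for all }\lambda\in\Omega\setminus\{\alpha\}.$$
   Context: A domain is a nonempty connected open set. A Hilbert space of functions on a set $\Omega$ is a complex Hilbert space $H$ whose elements are functions $\Omega\to\mathbb{C}$ (with pointwise operations) such that all point evaluations $h\mapsto h(\lambda)$, $\lambda\in\Omega$, are continuous; a Hilbert space of analytic functions on $\Omega$ is one all of whose elements are analytic. Its reproducing kernel is $k(\mu,\lambda)=k_\lambda(\mu)$, where $k_\lambda\in H$ satisfies $\langle f,k_\lambda\rangle=f(\lambda)$ for all $f\in H$. The kernel $k$ is nonsingular if for all $n$ and distinct $\lambda_1,\dots,\lambda_n\in\Omega$ the matrix $[k(\lambda_i,\lambda_j)]_{i,j=1}^n$ is nonsingular. $M_z$ is the operator $(M_zh)(\lambda)=\lambda h(\lambda)$. A multiplier of $H$ is a function $\theta:\Omega\to\mathbb{C}$ with $\theta f\in H$ for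 every $f\in H$. A subset $D\subset\Omega$ is a set of uniqueness for $H$ if $f,g\in H$ and $f|D=g|D$ imply $f=g$. Write $H|D=\{h|D:h\in H\}$. For $\psi:D_\psi\subset\Omega\to\mathbb{C}$ and $h\in H$, $\psi h$ denotes the function on $D_\psi$ given by the pointwise product of $\psi$ and $h|D_\psi$; for $E\subset H$, $\psi E=\{\psi h:h\in E\}$. Suppose $D_\psi$ is a set of uniqueness for $H$. A point $\alpha\in\Omega$ is a singularity of $\psi$ if there exists $h\in H$ with $h(\alpha)=0$ such that $\psi h$ has an extension $g\in H$ with $g(\alpha)\neq 0$ (necessarily $\alpha\notin D_\psi$). $\psi:D_\psi\subset\Omega\to\mathbb{C}$ is a $1$-pseudomultiplier of $H$ if: (1) $D_\psi$ is a set of uniqueness for $H$; (2) $\Omega\setminus D_\psi$ consists of singularities of $\psi$ and contains at most one point; (3) there is a closed subspace $E$ of codimension $1$ in $H$ such that $\psi E\subset H|D_\psi$. *)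

theory Defs
  imports "HOL-Analysis.Analysis" "Jordan_Normal_Form.Matrix"
begin

text \<open>
  A function on a set \<open>\<Omega>\<close> is represented by a total function that is \<open>0\<close> off \<open>\<Omega>\<close>,
  so that equality in \<open>H\<close> is equality of functions on \<open>\<Omega>\<close> and the vector space operations of
  \<open>H\<close> are the pointwise ones. The zero extension plays no role in analyticity, which is only ever
  asserted on an open \<open>\<Omega>\<close>.
\<close>

definition function_subspace :: "('a \<Rightarrow> complex) set \<Rightarrow> bool" where
  "function_subspace V \<longleftrightarrow>
     (\<lambda>_. 0) \<in> V \<and>
     (\<forall>f\<in>V. \<forall>g\<in>V. (\<lambda>z. f z + g z) \<in> V) \<and>
     (\<forall>c. \<forall>f\<in>V. (\<lambda>z. c * f z) \<in> V)"

definition hnorm :: "(('a \<Rightarrow> complex) \<Rightarrow> ('a \<Rightarrow> complex) \<Rightarrow> complex) \<Rightarrow> ('a \<Rightarrow> complex) \<Rightarrow> real" where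
  "hnorm ip f = sqrt (Re (ip f f))"

text \<open>
  The inner product is unconstrained off \<open>H\<close>. The guard is there because \<^locale>\<open>Metric_space\<close>
  demands nonnegativity and symmetry of the distance on the whole type.
\<close>

definition hdist :: "('a \<Rightarrow> complex) set \<Rightarrow> (('a \<Rightarrow> complex) \<Rightarrow> ('a \<Rightarrow> complex) \<Rightarrow> complex)
    \<Rightarrow> ('a \<Rightarrow> complex) \<Rightarrow> ('a \<Rightarrow> complex) \<Rightarrow> real" where
  "hdist H ip f g = (if f \<in> H \<and> g \<in> H then hnorm ip (\<lambda>z. f z - g z) else 0)"

abbreviation htopology :: "('a \<Rightarrow> complex) set \<Rightarrow> (('a \<Rightarrow> complex) \<Rightarrow> ('a \<Rightarrow> complex) \<Rightarrow> complex)
    \<Rightarrow> ('a \<Rightarrow> complex) topology" where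
  "htopology H ip \<equiv> Metric_space.mtopology H (hdist H ip)"

locale inner_product_function_space =
  fixes \<Omega> :: "'a set"
    and H :: "('a \<Rightarrow> complex) set"
    and ip :: "('a \<Rightarrow> complex) \<Rightarrow> ('a \<Rightarrow> complex) \<Rightarrow> complex"
  assumes vanishes_off: "\<And>f z. f \<in> H \<Longrightarrow> z \<notin> \<Omega> \<Longrightarrow> f z = 0"
    and subspace: "function_subspace H"
    and ip_add: "\<And>f g h. f \<in> H \<Longrightarrow> g \<in> H \<Longrightarrow> h \<in> H \<Longrightarrow> ip (\<lambda>z. f z + g z) h = ip f h + ip g h"
    and ip_scale: "\<And>c f h. f \<in> H \<Longrightarrow> h \<in> H \<Longrightarrow> ip (\<lambda>z. c * f z) h = c * ip f h"
    and ip_cnj: "\<And>f g. f \<in> H \<Longrightarrow> g \<in> H \<Longrightarrow> ip g f = cnj (ip f g)"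
    and ip_nonneg: "\<And>f. f \<in> H \<Longrightarrow> 0 \<le> Re (ip f f)"
    and ip_definite: "\<And>f. f \<in> H \<Longrightarrow> ip f f = 0 \<Longrightarrow> f = (\<lambda>_. 0)"

locale hilbert_function_space = inner_product_function_space \<Omega> H ip
  for \<Omega> :: "'a set" and H ip +
  assumes complete: "Metric_space.mcomplete H (hdist H ip)"
    and evaluation_continuous:
      "\<And>x. x \<in> \<Omega> \<Longrightarrow> continuous_map (htopology H ip) euclidean (\<lambda>h. h x)"

locale hilbert_space_of_analytic_functions = hilbert_function_space \<Omega> H ip
  for \<Omega> :: "complex set" and H ip +
  assumes analytic: "\<And>h. h \<in> H \<Longrightarrow> h analytic_on \<Omega>"

definition kernel_function :: "('a \<Rightarrow> complex) set \<Rightarrow> (('a \<Rightarrow> complex) \<Rightarrow> ('a \<Rightarrow> complex) \<Rightarrow> complex)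
    \<Rightarrow> 'a \<Rightarrow> ('a \<Rightarrow> complex)" where
  "kernel_function H ip x = (THE k. k \<in> H \<and> (\<forall>f\<in>H. ip f k = f x))"

definition reproducing_kernel :: "('a \<Rightarrow> complex) set \<Rightarrow> (('a \<Rightarrow> complex) \<Rightarrow> ('a \<Rightarrow> complex) \<Rightarrow> complex)
    \<Rightarrow> 'a \<Rightarrow> 'a \<Rightarrow> complex" where
  "reproducing_kernel H ip y x = kernel_function H ip x y"

definition nonsingular_kernel :: "'a set \<Rightarrow> ('a \<Rightarrow> 'a \<Rightarrow> complex) \<Rightarrow> bool" where
  "nonsingular_kernel \<Omega> k \<longleftrightarrow>
     (\<forall>n. \<forall>x :: nat \<Rightarrow> 'a. x ` {..<n} \<subseteq> \<Omega> \<longrightarrow> inj_on x {..<n} \<longrightarrow>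
        invertible_mat (Matrix.mat n n (\<lambda>(i, j). k (x i) (x j))))"

definition mult_by :: "('a \<Rightarrow> complex) \<Rightarrow> ('a \<Rightarrow> complex) \<Rightarrow> ('a \<Rightarrow> complex)" where
  "mult_by \<theta> h = (\<lambda>z. \<theta> z * h z)"

definition M_z :: "(complex \<Rightarrow> complex) \<Rightarrow> (complex \<Rightarrow> complex)" where
  "M_z = mult_by (\<lambda>z. z)"

text \<open>Values of \<open>\<theta>\<close> off \<open>\<Omega>\<close> are irrelevant here, since the elements of \<open>H\<close> vanish there.\<close>

definition multiplier :: "('a \<Rightarrow> complex) set \<Rightarrow> ('a \<Rightarrow> complex) \<Rightarrow> bool" where
  "multiplier H \<theta> \<longleftrightarrow> (\<forall>f\<in>H. mult_by \<theta> f \<in> H)"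

definition bounded_operator :: "('a \<Rightarrow> complex) set \<Rightarrow> (('a \<Rightarrow> complex) \<Rightarrow> ('a \<Rightarrow> complex) \<Rightarrow> complex)
    \<Rightarrow> (('a \<Rightarrow> complex) \<Rightarrow> ('a \<Rightarrow> complex)) \<Rightarrow> bool" where
  "bounded_operator H ip T \<longleftrightarrow>
     (\<forall>f\<in>H. T f \<in> H) \<and>
     (\<forall>f\<in>H. \<forall>g\<in>H. T (\<lambda>z. f z + g z) = (\<lambda>z. T f z + T g z)) \<and>
     (\<forall>c. \<forall>f\<in>H. T (\<lambda>z. c * f z) = (\<lambda>z. c * T f z)) \<and>
     (\<exists>C. \<forall>f\<in>H. hnorm ip (T f) \<le> C * hnorm ip f)"

definition set_of_uniqueness :: "'a set \<Rightarrow> ('a \<Rightarrow> complex) set \<Rightarrow> 'a set \<Rightarrow> bool" where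
  "set_of_uniqueness \<Omega> H D \<longleftrightarrow>
     D \<subseteq> \<Omega> \<and> (\<forall>f\<in>H. \<forall>g\<in>H. (\<forall>x\<in>D. f x = g x) \<longrightarrow> f = g)"

text \<open>
  A partially defined \<open>\<psi>\<close> is given by its domain \<open>D\<close> and a total function whose values off \<open>D\<close>
  are never used. In \<open>extends D \<psi> h g\<close> the function \<open>g\<close> restricts on \<open>D\<close> to \<open>\<psi>h\<close>.
\<close>

definition extends :: "'a set \<Rightarrow> ('a \<Rightarrow> complex) \<Rightarrow> ('a \<Rightarrow> complex) \<Rightarrow> ('a \<Rightarrow> complex) \<Rightarrow> bool" where
  "extends D \<psi> h g \<longleftrightarrow> (\<forall>x\<in>D. g x = \<psi> x * h x)"

definition singularity :: "'a set \<Rightarrow> ('a \<Rightarrow> complex) set \<Rightarrow> 'a set \<Rightarrow> ('a \<Rightarrow> complex) \<Rightarrow> 'a \<Rightarrow> bool" where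
  "singularity \<Omega> H D \<psi> \<alpha> \<longleftrightarrow>
     \<alpha> \<in> \<Omega> \<and> (\<exists>h\<in>H. h \<alpha> = 0 \<and> (\<exists>g\<in>H. extends D \<psi> h g \<and> g \<alpha> \<noteq> 0))"

text \<open>Codimension 1 means that the quotient \<open>H/E\<close> is spanned by one nonzero class, that of \<open>u\<close>.\<close>

definition codim_one :: "('a \<Rightarrow> complex) set \<Rightarrow> ('a \<Rightarrow> complex) set \<Rightarrow> bool" where
  "codim_one H E \<longleftrightarrow>
     (\<exists>u\<in>H. u \<notin> E \<and> (\<forall>h\<in>H. \<exists>c. (\<lambda>z. h z - c * u z) \<in> E))"

definition one_pseudomultiplier :: "'a set \<Rightarrow> ('a \<Rightarrow> complex) set
    \<Rightarrow> (('a \<Rightarrow> complex) \<Rightarrow> ('a \<Rightarrow> complex) \<Rightarrow> complex) \<Rightarrow> 'a set \<Rightarrow> ('a \<Rightarrow> complex) \<Rightarrow> bool" where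
  "one_pseudomultiplier \<Omega> H ip D \<psi> \<longleftrightarrow>
     set_of_uniqueness \<Omega> H D \<and>
     (\<forall>\<alpha>\<in>\<Omega> - D. singularity \<Omega> H D \<psi> \<alpha>) \<and>
     (\<exists>a. \<Omega> - D \<subseteq> {a}) \<and>
     (\<exists>E. E \<subseteq> H \<and> function_subspace E \<and> closedin (htopology H ip) E \<and> codim_one H E \<and>
          (\<forall>h\<in>E. \<exists>g\<in>H. extends D \<psi> h g))"

end

theory Submission
  imports Defs
begin

text \<open>
  Let \<open>F\<close> be the space of those \<open>h \<in> H\<close> for which \<open>\<phi>h\<close> extends to an element of \<open>H\<close>. It contains
  the given subspace \<open>E\<close> of codimension one, and it is invariant under \<open>M_z\<close>, since multiplication
  by \<open>z\<close> commutes with multiplication by \<open>\<phi>\<close>. So \<open>M_z\<close> acts on the quotient \<open>H/F\<close>, whose dimension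
  is at most one, as multiplication by a scalar \<open>\<alpha>\<close>; in other words \<open>(M_z - \<alpha>)H \<subseteq> F\<close>, and every
  product \<open>\<phi>(z - \<alpha>)h\<close> with \<open>h \<in> H\<close> extends from \<open>D\<close> to a unique element \<open>T h\<close> of \<open>H\<close>.

  The operator \<open>T\<close> multiplies by a fixed function on a set of uniqueness, and evaluations are
  continuous, so its graph is closed. By the closed graph theorem \<open>T\<close> is bounded
  (\<open>multiplication_on_uniqueness_set_bounded\<close>). It commutes with \<open>M_z\<close>, hence it is multiplication
  by a multiplier \<open>\<theta>\<close>. Nonsingularity of the kernel for single points says that the elements of
  \<open>H\<close> have no common zero in \<open>\<Omega>\<close> (\<open>nonsingular_kernel_nonvanishing\<close>), which permits cancelling
  \<open>h\<close> in \<open>\<phi>(z - \<alpha>)h = \<theta>h\<close> and gives the formula for \<open>\<phi>\<close> on \<open>D - {\<alpha>}\<close>.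

  Finally, let \<open>a\<close> be a point of \<open>\<Omega>\<close> outside \<open>D\<close>, and let \<open>h\<close>, \<open>g\<close> witness that it is a
  singularity. Then \<open>(z - \<alpha>)g\<close> and \<open>\<theta>h\<close> are elements of \<open>H\<close> that agree on \<open>D\<close>, so they are equal,
  and at \<open>a\<close> this reads \<open>(a - \<alpha>)g(a) = \<theta>(a)h(a) = 0\<close> with \<open>g(a) \<noteq> 0\<close>. Hence \<open>a = \<alpha>\<close>.
\<close>

section \<open>The norm of an inner product space of functions\<close>

context inner_product_function_space
begin

lemma zero_mem: "(\<lambda>_. 0) \<in> H"
  using subspace by (simp add: function_subspace_def)

lemma add_mem: "f \<in> H \<Longrightarrow> g \<in> H \<Longrightarrow> (\<lambda>z. f z + g z) \<in> H"
  using subspace by (simp add: function_subspace_def)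

lemma scale_mem: "f \<in> H \<Longrightarrow> (\<lambda>z. c * f z) \<in> H"
  using subspace by (simp add: function_subspace_def)

lemma diff_mem:
  assumes "f \<in> H" "g \<in> H"
  shows "(\<lambda>z. f z - g z) \<in> H"
  using add_mem[OF assms(1) scale_mem[OF assms(2), of "-1"]] by simp

lemma hnorm_nonneg: "f \<in> H \<Longrightarrow> 0 \<le> hnorm ip f"
  by (simp add: hnorm_def ip_nonneg)

lemma hnorm_square: "f \<in> H \<Longrightarrow> (hnorm ip f)\<^sup>2 = Re (ip f f)"
  by (simp add: hnorm_def ip_nonneg)

lemma Im_ip_self:
  assumes "f \<in> H"
  shows "Im (ip f f) = 0"
  using arg_cong[OF ip_cnj[OF assms assms], of Im] by simp

lemma ip_zero_left:
  assumes "h \<in> H"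
  shows "ip (\<lambda>_. 0) h = 0"
  using ip_scale[OF zero_mem assms, of 0] by simp

lemma hnorm_zero: "hnorm ip (\<lambda>_. 0) = 0"
  by (simp add: hnorm_def ip_zero_left[OF zero_mem])

lemma hnorm_eq_zero:
  assumes "f \<in> H" "hnorm ip f = 0"
  shows "f = (\<lambda>_. 0)"
proof (rule ip_definite[OF assms(1)])
  have "Re (ip f f) = 0"
    using hnorm_square[OF assms(1)] assms(2) by simp
  then show "ip f f = 0"
    using Im_ip_self[OF assms(1)] by (simp add: complex_eq_iff)
qed

lemma ip_scale_right:
  assumes "f \<in> H" "g \<in> H"
  shows "ip f (\<lambda>z. c * g z) = cnj c * ip f g"
proof -
  have "ip f (\<lambda>z. c * g z) = cnj (ip (\<lambda>z. c * g z) f)"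
    by (rule ip_cnj[OF scale_mem[OF assms(2)] assms(1)])
  also have "\<dots> = cnj c * ip f g"
    by (simp add: ip_scale assms ip_cnj[OF assms(2,1), symmetric])
  finally show ?thesis .
qed

lemma hnorm_scale:
  assumes "f \<in> H"
  shows "hnorm ip (\<lambda>z. c * f z) = cmod c * hnorm ip f"
proof -
  have "ip (\<lambda>z. c * f z) (\<lambda>z. c * f z) = (c * cnj c) * ip f f"
    using assms by (simp add: ip_scale ip_scale_right scale_mem)
  also have "c * cnj c = of_real ((cmod c)\<^sup>2)"
    by (rule complex_norm_square[symmetric])
  finally have "Re (ip (\<lambda>z. c * f z) (\<lambda>z. c * f z)) = (cmod c)\<^sup>2 * Re (ip f f)"
    by (simp del: of_real_power)
  then show ?thesis
    by (simp add: hnorm_def real_sqrt_mult)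
qed

lemma hnorm_diff_commute:
  assumes "f \<in> H" "g \<in> H"
  shows "hnorm ip (\<lambda>z. f z - g z) = hnorm ip (\<lambda>z. g z - f z)"
  using hnorm_scale[OF diff_mem[OF assms], of "-1"] by simp

lemma hnorm_add_square:
  assumes "f \<in> H" "g \<in> H"
  shows "(hnorm ip (\<lambda>z. f z + g z))\<^sup>2 = (hnorm ip f)\<^sup>2 + 2 * Re (ip f g) + (hnorm ip g)\<^sup>2"
proof -
  have right: "ip h (\<lambda>z. f z + g z) = ip h f + ip h g" if "h \<in> H" for h
  proof -
    have "ip h (\<lambda>z. f z + g z) = cnj (ip (\<lambda>z. f z + g z) h)"
      by (rule ip_cnj[OF add_mem[OF assms] that])
    also have "\<dots> = cnj (ip f h) + cnj (ip g h)"
      by (simp add: ip_add assms that)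
    also have "\<dots> = ip h f + ip h g"
      by (simp only: ip_cnj[OF assms(1) that, symmetric] ip_cnj[OF assms(2) that, symmetric])
    finally show ?thesis .
  qed
  have "ip (\<lambda>z. f z + g z) (\<lambda>z. f z + g z) = (ip f f + ip f g) + (ip g f + ip g g)"
    by (simp add: ip_add assms add_mem right)
  moreover have "Re (ip g f) = Re (ip f g)"
    using arg_cong[OF ip_cnj[OF assms], of Re] by simp
  ultimately show ?thesis
    by (simp add: hnorm_square assms add_mem)
qed

text \<open>
  The bound on the real part is all that the triangle inequality needs, and for it the usual
  argument by minimising \<open>\<parallel>f + t g\<parallel>\<close> runs over real \<open>t\<close> only.
\<close>

lemma Re_ip_le:
  assumes "f \<in> H" "g \<in> H"
  shows "Re (ip f g) \<le> hnorm ip f * hnorm ip g"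
proof (cases "hnorm ip g = 0")
  case True
  then have "g = (\<lambda>_. 0)"
    by (rule hnorm_eq_zero[OF assms(2)])
  then show ?thesis
    by (simp add: hnorm_zero ip_zero_left[OF assms(1)] ip_cnj[OF zero_mem assms(1)])
next
  case False
  define a b c where "a = hnorm ip f" and "b = Re (ip f g)" and "c = hnorm ip g"
  have nonneg: "0 \<le> a" "0 < c"
    using hnorm_nonneg assms False by (auto simp: a_def c_def order_le_less)
  define t where "t = - b / c\<^sup>2"
  have "0 \<le> (hnorm ip (\<lambda>z. f z + of_real t * g z))\<^sup>2"
    by simp
  also have "\<dots> = a\<^sup>2 + 2 * (t * b) + (\<bar>t\<bar> * c)\<^sup>2"
    using hnorm_add_square[OF assms(1) scale_mem[OF assms(2)], of "of_real t"]
    by (simp add: hnorm_scale assms ip_scale_right a_def b_def c_def)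
  also have "\<dots> = a\<^sup>2 - b\<^sup>2 / c\<^sup>2"
    using nonneg by (simp add: t_def field_simps power2_eq_square)
  finally have "b\<^sup>2 \<le> (a * c)\<^sup>2"
    using nonneg by (simp add: field_simps)
  then have "b \<le> a * c"
    using nonneg by (intro power2_le_imp_le[of b "a * c"]) auto
  then show ?thesis
    by (simp add: a_def b_def c_def)
qed

lemma hnorm_triangle:
  assumes "f \<in> H" "g \<in> H"
  shows "hnorm ip (\<lambda>z. f z + g z) \<le> hnorm ip f + hnorm ip g"
proof (rule power2_le_imp_le)
  show "(hnorm ip (\<lambda>z. f z + g z))\<^sup>2 \<le> (hnorm ip f + hnorm ip g)\<^sup>2"
    using Re_ip_le[OF assms] by (simp add: hnorm_add_square[OF assms] power2_sum)
qed (simp add: hnorm_nonneg assms)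

lemma hnorm_diff_triangle:
  assumes "f \<in> H" "g \<in> H"
  shows "hnorm ip (\<lambda>z. f z - g z) \<le> hnorm ip f + hnorm ip g"
  using hnorm_triangle[OF assms(1) scale_mem[OF assms(2), of "-1"]]
    hnorm_scale[OF assms(2), of "-1"] by simp

lemma Metric_space_hdist: "Metric_space H (hdist H ip)"
proof
  show "0 \<le> hdist H ip f g" for f g
    by (simp add: hdist_def hnorm_nonneg diff_mem)
  show "hdist H ip f g = hdist H ip g f" for f g
    by (auto simp: hdist_def intro: hnorm_diff_commute)
  show "hdist H ip f g = 0 \<longleftrightarrow> f = g" if "f \<in> H" "g \<in> H" for f g
    using hnorm_eq_zero[OF diff_mem[OF that]] that
    by (auto simp: hdist_def hnorm_zero fun_eq_iff)
  show "hdist H ip f h \<le> hdist H ip f g + hdist H ip g h"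
    if "f \<in> H" "g \<in> H" "h \<in> H" for f g h
    using hnorm_triangle[OF diff_mem[OF that(1,2)] diff_mem[OF that(2,3)]] that
    by (simp add: hdist_def)
qed

sublocale Hm: Metric_space H "hdist H ip"
  by (rule Metric_space_hdist)

end

section \<open>The closed graph theorem\<close>

context hilbert_function_space
begin

text \<open>
  Baire's theorem yields a ball in which the points with \<open>\<parallel>T f\<parallel> \<le> n\<close> are dense for some \<open>n\<close>.
  Differences of such points approximate every vector of the ball of the same radius about \<open>0\<close>,
  and scaling extends this to all of \<open>H\<close>.
\<close>

lemma approximation_with_bounded_image:
  assumes maps: "\<And>f. f \<in> H \<Longrightarrow> T f \<in> H"
    and add: "\<And>f g. f \<in> H \<Longrightarrow> g \<in> H \<Longrightarrow> T (\<lambda>z. f z + g z) = (\<lambda>z. T f z + T g z)"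
    and scale: "\<And>c f. f \<in> H \<Longrightarrow> T (\<lambda>z. c * f z) = (\<lambda>z. c * T f z)"
  shows "\<exists>K\<ge>0. \<forall>f\<in>H. \<forall>\<epsilon>>0.
    \<exists>p\<in>H. hnorm ip (\<lambda>z. f z - p z) < \<epsilon> \<and> hnorm ip (T p) \<le> K * hnorm ip f"
proof -
  have diff: "T (\<lambda>z. f z - g z) = (\<lambda>z. T f z - T g z)" if "f \<in> H" "g \<in> H" for f g
    using add[OF that(1) scale_mem[OF that(2)], of "-1"] scale[OF that(2), of "-1"] by simp
  define A where "A = (\<lambda>n::nat. {f\<in>H. hnorm ip (T f) \<le> real n})"
  have "\<exists>n. htopology H ip interior_of (htopology H ip closure_of A n) \<noteq> {}"
  proof (rule ccontr)
    assume "\<not> ?thesis"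
    then have "htopology H ip interior_of \<Union>(range (\<lambda>n. htopology H ip closure_of A n)) = {}"
      by (intro Hm.metric_Baire_category_alt[OF complete]) auto
    moreover have "\<Union>(range (\<lambda>n. htopology H ip closure_of A n)) = H"
    proof
      show "\<Union>(range (\<lambda>n. htopology H ip closure_of A n)) \<subseteq> H"
        using closure_of_subset_topspace[of "htopology H ip"] by auto
      show "H \<subseteq> \<Union>(range (\<lambda>n. htopology H ip closure_of A n))"
      proof
        fix f assume "f \<in> H"
        obtain n where "hnorm ip (T f) \<le> real n"
          using real_arch_simple by blast
        then have "f \<in> A n"
          using \<open>f \<in> H\<close> by (simp add: A_def)
        moreover have "A n \<subseteq> htopology H ip closure_of A n"
          by (rule closure_of_subset) (auto simp: A_def)
        ultimately show "f \<in> \<Union>(range (\<lambda>n. htopology H ip closure_of A n))"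
          by blast
      qed
    qed
    moreover have "htopology H ip interior_of H = H"
      using interior_of_topspace[of "htopology H ip"] by simp
    ultimately show False
      using zero_mem by auto
  qed
  then obtain n x r where x: "x \<in> H" and r: "0 < r"
    and dense: "Hm.mball x r \<subseteq> htopology H ip closure_of A n"
    by (auto simp: Hm.metric_interior_of)
  have near: "\<exists>a\<in>H. hnorm ip (\<lambda>z. y z - a z) < \<epsilon> \<and> hnorm ip (T a) \<le> real n"
    if "y \<in> H" "hnorm ip (\<lambda>z. x z - y z) < r" "0 < \<epsilon>" for y \<epsilon>
  proof -
    have "y \<in> Hm.mball x r"
      using that x by (simp add: hdist_def)
    then have "y \<in> htopology H ip closure_of A n"
      using dense by blast
    then obtain a where "a \<in> A n" "a \<in> Hm.mball y \<epsilon>"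
      using \<open>0 < \<epsilon>\<close> by (auto simp: Hm.metric_closure_of)
    then show ?thesis
      using that by (auto simp: A_def hdist_def)
  qed
  have ball: "\<exists>p\<in>H. hnorm ip (\<lambda>z. f z - p z) < \<epsilon> \<and> hnorm ip (T p) \<le> 2 * real n"
    if f: "f \<in> H" "hnorm ip f < r" and \<epsilon>: "0 < \<epsilon>" for f \<epsilon>
  proof -
    have xf: "(\<lambda>z. x z + f z) \<in> H"
      using add_mem x f by simp
    have "hnorm ip (\<lambda>z. x z - (x z + f z)) < r"
      using hnorm_scale[OF f(1), of "-1"] f(2) by simp
    then obtain b where b: "b \<in> H" "hnorm ip (\<lambda>z. x z + f z - b z) < \<epsilon> / 2"
        "hnorm ip (T b) \<le> real n"
      using near[OF xf, of "\<epsilon> / 2"] \<epsilon> by auto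
    obtain a where a: "a \<in> H" "hnorm ip (\<lambda>z. x z - a z) < \<epsilon> / 2" "hnorm ip (T a) \<le> real n"
      using near[OF x, of "\<epsilon> / 2"] \<epsilon> r by (auto simp: hnorm_zero)
    have "hnorm ip (\<lambda>z. (x z + f z - b z) - (x z - a z)) < \<epsilon>"
      using hnorm_diff_triangle[OF diff_mem[OF xf b(1)] diff_mem[OF x a(1)]] a(2) b(2) by linarith
    then have "hnorm ip (\<lambda>z. f z - (b z - a z)) < \<epsilon>"
      by (simp add: algebra_simps)
    moreover have "hnorm ip (T (\<lambda>z. b z - a z)) \<le> 2 * real n"
      using hnorm_diff_triangle[OF maps[OF b(1)] maps[OF a(1)]] a(3) b(3)
      by (simp add: diff[OF b(1) a(1)])
    ultimately show ?thesis
      using diff_mem[OF b(1) a(1)] by (intro bexI[of _ "\<lambda>z. b z - a z"] conjI)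
  qed
  show ?thesis
  proof (intro exI[of _ "4 * real n / r"] conjI ballI allI impI)
    show "0 \<le> 4 * real n / r"
      using r by simp
  next
    fix f \<epsilon> assume f: "f \<in> H" and \<epsilon>: "0 < (\<epsilon>::real)"
    show "\<exists>p\<in>H. hnorm ip (\<lambda>z. f z - p z) < \<epsilon> \<and> hnorm ip (T p) \<le> 4 * real n / r * hnorm ip f"
    proof (cases "hnorm ip f = 0")
      case True
      have "T (\<lambda>_. 0) = (\<lambda>_. 0)"
        using scale[OF zero_mem, of 0] by simp
      moreover have "f = (\<lambda>_. 0)"
        using hnorm_eq_zero[OF f True] .
      ultimately show ?thesis
        using zero_mem \<epsilon> by (intro bexI[of _ "\<lambda>_. 0"]) (auto simp: hnorm_zero)
    next
      case False
      then have pos: "0 < hnorm ip f"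
        using hnorm_nonneg[OF f] by simp
      define s where "s = r / (2 * hnorm ip f)"
      have s: "0 < s" "s * hnorm ip f < r"
        using pos r by (auto simp: s_def field_simps)
      have "hnorm ip (\<lambda>z. of_real s * f z) < r"
        using s by (simp add: hnorm_scale[OF f])
      then obtain q where q: "q \<in> H" "hnorm ip (\<lambda>z. of_real s * f z - q z) < s * \<epsilon>"
          "hnorm ip (T q) \<le> 2 * real n"
        using ball[OF scale_mem[OF f], of "of_real s" "s * \<epsilon>"] s \<epsilon> by auto
      define p where "p = (\<lambda>z. of_real (inverse s) * q z)"
      have p: "p \<in> H"
        by (simp add: p_def scale_mem q(1))
      have "(\<lambda>z. f z - p z) = (\<lambda>z. of_real (inverse s) * (of_real s * f z - q z))"
        using s(1) by (auto simp: p_def fun_eq_iff field_simps)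
      then have "hnorm ip (\<lambda>z. f z - p z) =
          inverse s * hnorm ip (\<lambda>z. of_real s * f z - q z)"
        using s(1) hnorm_scale[OF diff_mem[OF scale_mem[OF f] q(1)], of "of_real (inverse s)" "of_real s"]
        by (simp add: norm_inverse)
      also have "\<dots> < inverse s * (s * \<epsilon>)"
        using q(2) s(1) by (intro mult_strict_left_mono) auto
      also have "\<dots> = \<epsilon>"
        using s(1) by (simp add: field_simps)
      finally have "hnorm ip (\<lambda>z. f z - p z) < \<epsilon>" .
      moreover have "hnorm ip (T p) \<le> 4 * real n / r * hnorm ip f"
      proof -
        have "hnorm ip (T p) = inverse s * hnorm ip (T q)"
          using s(1) hnorm_scale[OF maps[OF q(1)], of "of_real (inverse s)"]
          unfolding p_def scale[OF q(1)] by (simp add: norm_inverse)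
        also have "\<dots> \<le> inverse s * (2 * real n)"
          using q(3) s(1) by (intro mult_left_mono) auto
        also have "\<dots> = 4 * real n / r * hnorm ip f"
          using pos r by (simp add: s_def field_simps)
        finally show ?thesis .
      qed
      ultimately show ?thesis
        using p by blast
    qed
  qed
qed

text \<open>
  Successive approximation: subtracting from the current remainder an approximant with controlled
  image halves the remainder, so \<open>f\<close> is the limit of partial sums whose images form a Cauchy
  sequence bounded by a multiple of \<open>\<parallel>f\<parallel>\<close>. Closedness of the graph identifies the limit of the
  images as \<open>T f\<close>.
\<close>

theorem closed_graph:
  assumes maps: "\<And>f. f \<in> H \<Longrightarrow> T f \<in> H"
    and add: "\<And>f g. f \<in> H \<Longrightarrow> g \<in> H \<Longrightarrow> T (\<lambda>z. f z + g z) = (\<lambda>z. T f z + T g z)"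
    and scale: "\<And>c f. f \<in> H \<Longrightarrow> T (\<lambda>z. c * f z) = (\<lambda>z. c * T f z)"
    and closed: "\<And>s f g. range s \<subseteq> H \<Longrightarrow> limitin (htopology H ip) s f sequentially \<Longrightarrow>
      limitin (htopology H ip) (\<lambda>n. T (s n)) g sequentially \<Longrightarrow> T f = g"
  shows "bounded_operator H ip T"
proof -
  have diff: "T (\<lambda>z. f z - g z) = (\<lambda>z. T f z - T g z)" if "f \<in> H" "g \<in> H" for f g
    using add[OF that(1) scale_mem[OF that(2)], of "-1"] scale[OF that(2), of "-1"] by simp
  have "\<exists>K\<ge>0. \<forall>f\<in>H. \<forall>\<epsilon>>0.
      \<exists>p\<in>H. hnorm ip (\<lambda>z. f z - p z) < \<epsilon> \<and> hnorm ip (T p) \<le> K * hnorm ip f"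
    by (rule approximation_with_bounded_image) (simp_all add: maps add scale)
  then obtain K where K: "0 \<le> K"
    and ex: "\<forall>f\<in>H. \<forall>\<epsilon>>0.
      \<exists>p\<in>H. hnorm ip (\<lambda>z. f z - p z) < \<epsilon> \<and> hnorm ip (T p) \<le> K * hnorm ip f"
    by blast
  define P where "P = (\<lambda>f \<epsilon>. SOME p. p \<in> H \<and>
      hnorm ip (\<lambda>z. f z - p z) < \<epsilon> \<and> hnorm ip (T p) \<le> K * hnorm ip f)"
  have P: "P f \<epsilon> \<in> H \<and>
      hnorm ip (\<lambda>z. f z - P f \<epsilon> z) < \<epsilon> \<and> hnorm ip (T (P f \<epsilon>)) \<le> K * hnorm ip f"
    if "f \<in> H" "0 < \<epsilon>" for f \<epsilon>
    using someI_ex[OF ex[rule_format, OF that, unfolded Bex_def]] unfolding P_def .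
  have bound: "hnorm ip (T f) \<le> 2 * K * hnorm ip f" if f: "f \<in> H" for f
  proof (cases "hnorm ip f = 0")
    case True
    then have "f = (\<lambda>_. 0)"
      using hnorm_eq_zero[OF f] by simp
    moreover have "T (\<lambda>_. 0) = (\<lambda>_. 0)"
      using scale[OF zero_mem, of 0] by simp
    ultimately show ?thesis
      by (simp add: hnorm_zero)
  next
    case False
    define b where "b = hnorm ip f"
    have b: "0 < b"
      using False hnorm_nonneg[OF f] by (simp add: b_def)
    \<comment> \<open>\<open>R n\<close> is the remainder after \<open>n\<close> steps, \<open>s n = f - R n\<close> the corresponding partial sum.\<close>
    define R where "R = rec_nat f (\<lambda>n g z. g z - P g (b / 2 ^ Suc n) z)"
    have R0: "R 0 = f" and RS: "R (Suc n) = (\<lambda>z. R n z - P (R n) (b / 2 ^ Suc n) z)" for n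
      by (simp_all add: R_def)
    have R: "R n \<in> H \<and> hnorm ip (R n) \<le> b / 2 ^ n" for n
    proof (induction n)
      case 0
      show ?case
        using f by (simp add: R0 b_def)
    next
      case (Suc n)
      then show ?case
        using P[of "R n" "b / 2 ^ Suc n"] b unfolding RS by (auto intro!: diff_mem)
    qed
    define s where "s = (\<lambda>n z. f z - R n z)"
    have s: "s n \<in> H" for n
      unfolding s_def using diff_mem f R by simp
    have step: "hnorm ip (\<lambda>z. T (s (Suc n)) z - T (s n) z) \<le> K * b / 2 ^ n" for n
    proof -
      let ?p = "P (R n) (b / 2 ^ Suc n)"
      have "T (\<lambda>z. s (Suc n) z - s n z) = T ?p"
        by (simp add: s_def RS)
      then have "hnorm ip (\<lambda>z. T (s (Suc n)) z - T (s n) z) = hnorm ip (T ?p)"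
        by (simp add: diff s)
      also have "\<dots> \<le> K * hnorm ip (R n)"
        using P[of "R n" "b / 2 ^ Suc n"] R b by simp
      also have "\<dots> \<le> K * (b / 2 ^ n)"
        using R K by (intro mult_left_mono) auto
      finally show ?thesis by simp
    qed
    have tail: "hnorm ip (\<lambda>z. T (s (m + k)) z - T (s m) z)
        \<le> 2 * K * b / 2 ^ m - 2 * K * b / 2 ^ (m + k)"
      for m k
    proof (induction k)
      case 0
      show ?case by (simp add: hnorm_zero)
    next
      case (Suc k)
      have "hnorm ip (\<lambda>z. T (s (m + Suc k)) z - T (s m) z)
          \<le> hnorm ip (\<lambda>z. T (s (Suc (m + k))) z - T (s (m + k)) z)
            + hnorm ip (\<lambda>z. T (s (m + k)) z - T (s m) z)"
        using hnorm_triangle[OF diff_mem[OF maps[OF s[of "Suc (m + k)"]] maps[OF s[of "m + k"]]]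
            diff_mem[OF maps[OF s[of "m + k"]] maps[OF s[of m]]]]
        by simp
      also have "\<dots> \<le> K * b / 2 ^ (m + k) + (2 * K * b / 2 ^ m - 2 * K * b / 2 ^ (m + k))"
        using step[of "m + k"] Suc.IH by linarith
      also have "\<dots> = 2 * K * b / 2 ^ m - 2 * K * b / 2 ^ (m + Suc k)"
        by (simp add: field_simps)
      finally show ?case .
    qed
    have tail': "hnorm ip (\<lambda>z. T (s n) z - T (s m) z) \<le> 2 * K * b / 2 ^ m" if "m \<le> n" for m n
    proof -
      have "0 \<le> 2 * K * b / 2 ^ n"
        using K b by simp
      then show ?thesis
        using tail[of m "n - m"] that by simp
    qed
    have small: "\<exists>N. \<forall>m\<ge>N. c / 2 ^ m < e" if "0 < e" for c e :: real
    proof -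
      have "(\<lambda>m. c * (1 / 2) ^ m) \<longlonglongrightarrow> 0"
        by (intro tendsto_mult_right_zero LIMSEQ_power_zero) simp
      then have "(\<lambda>m. c / 2 ^ m) \<longlonglongrightarrow> 0"
        by (simp add: power_divide)
      from order_tendstoD(2)[OF this that] show ?thesis
        by (simp only: eventually_sequentially)
    qed
    have "Hm.MCauchy (\<lambda>n. T (s n))"
      unfolding Hm.MCauchy_def
    proof (intro conjI allI impI)
      show "range (\<lambda>n. T (s n)) \<subseteq> H"
        using maps s by blast
      fix e :: real assume "0 < e"
      then obtain N where N: "\<And>m. N \<le> m \<Longrightarrow> 2 * K * b / 2 ^ m < e"
        using small by blast
      have "hdist H ip (T (s n)) (T (s m)) < e" if "N \<le> m" "m \<le> n" for m n
        using tail'[OF that(2)] N[OF that(1)] by (simp add: hdist_def maps s)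
      then show "\<exists>N. \<forall>n n'. N \<le> n \<longrightarrow> N \<le> n' \<longrightarrow> hdist H ip (T (s n)) (T (s n')) < e"
        by (metis Hm.commute linear)
    qed
    then obtain g where g: "limitin (htopology H ip) (\<lambda>n. T (s n)) g sequentially"
      using complete Hm.mcomplete_def by blast
    have "limitin (htopology H ip) s f sequentially"
      unfolding Hm.limitin_metric
    proof (intro conjI allI impI f)
      fix e :: real assume "0 < e"
      then obtain N where N: "\<And>m. N \<le> m \<Longrightarrow> b / 2 ^ m < e"
        using small by blast
      have "hdist H ip (s m) f < e" if "N \<le> m" for m
      proof -
        have "hdist H ip (s m) f = hnorm ip (R m)"
          using hnorm_scale[of "R m" "-1"] R[of m] f s[of m] by (simp add: hdist_def) (simp add: s_def)
        then show ?thesis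
          using R[of m] N[OF that] by simp
      qed
      then show "\<forall>\<^sub>F n in sequentially. s n \<in> H \<and> hdist H ip (s n) f < e"
        using s by (auto simp: eventually_sequentially)
    qed
    then have Tf: "T f = g"
      using closed[of s f g] s g by blast
    show ?thesis
    proof (rule field_le_epsilon)
      fix e :: real assume "0 < e"
      then obtain n where n: "hdist H ip (T (s n)) (T f) < e"
        using g Tf by (force simp: Hm.limitin_metric eventually_sequentially)
      \<comment> \<open>The partial sums start at \<open>s 0 = 0\<close>, so \<open>tail'\<close> with \<open>m = 0\<close> bounds \<open>T (s n)\<close> itself.\<close>
      have "T (s 0) = (\<lambda>_. 0)"
        using scale[OF zero_mem, of 0] by (simp add: s_def R0)
      then have "hnorm ip (T (s n)) \<le> 2 * K * b"
        using tail'[of 0 n] by simp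
      moreover have "hnorm ip (\<lambda>z. T (s n) z - T f z) < e"
        using n by (simp add: hdist_def maps s f)
      moreover have "hnorm ip (T f) \<le> hnorm ip (T (s n)) + hnorm ip (\<lambda>z. T (s n) z - T f z)"
        using hnorm_diff_triangle[OF maps[OF s[of n]] diff_mem[OF maps[OF s[of n]] maps[OF f]]]
        by simp
      ultimately show "hnorm ip (T f) \<le> 2 * K * hnorm ip f + e"
        by (simp add: b_def)
    qed
  qed
  show ?thesis
    unfolding bounded_operator_def using maps add scale bound by blast
qed

section \<open>Multiplication on a set of uniqueness\<close>

text \<open>
  Linearity and closedness of the graph are identities between elements of \<open>H\<close>, so it is enough
  to verify them at the points of \<open>D\<close>. There \<open>T\<close> is multiplication by \<open>w\<close>, and convergence in
  norm implies pointwise convergence because evaluations are continuous.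
\<close>

lemma multiplication_on_uniqueness_set_bounded:
  assumes D: "set_of_uniqueness \<Omega> H D"
    and maps: "\<And>f. f \<in> H \<Longrightarrow> T f \<in> H"
    and T: "\<And>f. f \<in> H \<Longrightarrow> extends D w f (T f)"
  shows "bounded_operator H ip T"
proof (rule closed_graph)
  show "T f \<in> H" if "f \<in> H" for f
    using that by (rule maps)
  have eqI: "f = g" if "f \<in> H" "g \<in> H" "\<And>x. x \<in> D \<Longrightarrow> f x = g x" for f g
    using D that by (simp add: set_of_uniqueness_def)
  have TD: "T f x = w x * f x" if "f \<in> H" "x \<in> D" for f x
    using T that by (simp add: extends_def)
  show "T (\<lambda>z. f z + g z) = (\<lambda>z. T f z + T g z)" if "f \<in> H" "g \<in> H" for f g
    using that by (intro eqI) (auto simp: TD add_mem maps algebra_simps)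
  show "T (\<lambda>z. c * f z) = (\<lambda>z. c * T f z)" if "f \<in> H" for c f
    using that by (intro eqI) (auto simp: TD scale_mem maps)
  fix s f g
  assume s: "range s \<subseteq> H" and f: "limitin (htopology H ip) s f sequentially"
    and g: "limitin (htopology H ip) (\<lambda>n. T (s n)) g sequentially"
  have fg: "f \<in> H" "g \<in> H"
    using f g by (auto simp: Hm.limitin_metric)
  show "T f = g"
  proof (rule eqI)
    fix x assume x: "x \<in> D"
    then have "x \<in> \<Omega>"
      using D by (auto simp: set_of_uniqueness_def)
    then have ev: "(\<lambda>n. u n x) \<longlonglongrightarrow> v x" if "limitin (htopology H ip) u v sequentially" for u v
      using continuous_map_limit[OF evaluation_continuous that] by (simp add: o_def)
    have "(\<lambda>n. w x * s n x) \<longlonglongrightarrow> w x * f x"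
      using ev[OF f] by (rule tendsto_mult_left)
    moreover have "(\<lambda>n. w x * s n x) = (\<lambda>n. T (s n) x)"
      using s x TD by (auto simp: fun_eq_iff image_subset_iff)
    ultimately have "w x * f x = g x"
      using ev[OF g] LIMSEQ_unique by metis
    then show "T f x = g x"
      using TD fg x by simp
  qed (use fg maps in auto)
qed

section \<open>Nonsingular kernels\<close>

text \<open>
  If every element of \<open>H\<close> vanished at \<open>x\<close>, the kernel function at \<open>x\<close> would be zero, and the
  one-by-one matrix \<open>[k(x, x)]\<close> would be singular.
\<close>

lemma nonsingular_kernel_nonvanishing:
  assumes ns: "nonsingular_kernel \<Omega> (reproducing_kernel H ip)" and x: "x \<in> \<Omega>"
  shows "\<exists>h\<in>H. h x \<noteq> 0"
proof (rule ccontr)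
  assume "\<not> ?thesis"
  then have vanish: "\<And>h. h \<in> H \<Longrightarrow> h x = 0"
    by blast
  have "kernel_function H ip x = (\<lambda>_. 0)"
    unfolding kernel_function_def
  proof (rule the_equality)
    have "ip f (\<lambda>_. 0) = 0" if "f \<in> H" for f
      using ip_cnj[OF zero_mem that] ip_zero_left[OF that] by simp
    then show "(\<lambda>_. 0) \<in> H \<and> (\<forall>f\<in>H. ip f (\<lambda>_. 0) = f x)"
      using vanish zero_mem by simp
    show "k = (\<lambda>_. 0)" if "k \<in> H \<and> (\<forall>f\<in>H. ip f k = f x)" for k
      using that vanish ip_definite by metis
  qed
  then have k: "reproducing_kernel H ip x x = 0"
    by (simp add: reproducing_kernel_def)
  let ?A = "Matrix.mat 1 1 (\<lambda>(i, j). reproducing_kernel H ip ((\<lambda>_::nat. x) i) ((\<lambda>_::nat. x) j))"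
  have "(\<lambda>_::nat. x) ` {..<1} \<subseteq> \<Omega> \<longrightarrow> inj_on (\<lambda>_::nat. x) {..<1} \<longrightarrow> invertible_mat ?A"
    using ns unfolding nonsingular_kernel_def by blast
  moreover have "inj_on (\<lambda>_::nat. x) {..<1}"
    by (auto simp: inj_on_def)
  ultimately have "invertible_mat ?A"
    using x by auto
  then obtain B where B: "?A * B = 1\<^sub>m 1" "B * ?A = 1\<^sub>m (dim_row B)"
    by (auto simp: invertible_mat_def inverts_mat_def)
  have "dim_col B = 1"
    using arg_cong[OF B(1), of dim_col] by simp
  have "dim_row B = 1"
    using arg_cong[OF B(2), of dim_col] by simp
  then have "(?A * B) $$ (0, 0) = 0"
    using \<open>dim_col B = 1\<close> by (simp add: k scalar_prod_def)
  then show False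
    unfolding B(1) by simp
qed

end

section \<open>Pseudomultipliers\<close>

text \<open>
  The scalar \<open>\<alpha>\<close> is the one by which multiplication by \<open>w\<close> acts on the quotient of \<open>H\<close> by the
  space of all \<open>h\<close> for which \<open>\<phi>h\<close> extends. It is read off from a vector \<open>u\<close> spanning a complement
  of \<open>E\<close>, as the coefficient in \<open>w u = \<alpha> u + e\<close> with \<open>e \<in> E\<close>. For \<open>h = c u + f\<close> with \<open>f \<in> E\<close> this
  gives \<open>\<phi>(w - \<alpha>)h = c \<phi>e + (w - \<alpha>)\<phi>f\<close>, where \<open>\<phi>e\<close> and \<open>\<phi>f\<close> extend to elements \<open>g1\<close>, \<open>g2\<close> of \<open>H\<close>
  and \<open>H\<close> is invariant under multiplication by \<open>w - \<alpha>\<close>.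
\<close>

lemma (in inner_product_function_space) codim_one_shift:
  fixes w :: "'a \<Rightarrow> complex"
  assumes inv: "\<And>h. h \<in> H \<Longrightarrow> mult_by w h \<in> H"
    and E: "E \<subseteq> H" "codim_one H E"
    and ext: "\<And>h. h \<in> E \<Longrightarrow> \<exists>g\<in>H. extends D \<phi> h g"
  shows "\<exists>\<alpha>. \<forall>h\<in>H. \<exists>g\<in>H. extends D (\<lambda>x. \<phi> x * (w x - \<alpha>)) h g"
proof -
  obtain u where u: "u \<in> H" and span: "\<And>h. h \<in> H \<Longrightarrow> \<exists>c. (\<lambda>z. h z - c * u z) \<in> E"
    using E(2) by (auto simp: codim_one_def)
  obtain \<alpha> where "(\<lambda>z. mult_by w u z - \<alpha> * u z) \<in> E"
    using span[OF inv[OF u]] by blast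
  then obtain g1 where g1: "g1 \<in> H" "\<And>x. x \<in> D \<Longrightarrow> g1 x = \<phi> x * (w x * u x - \<alpha> * u x)"
    using ext by (force simp: extends_def mult_by_def)
  show ?thesis
  proof (intro exI[of _ \<alpha>] ballI)
    fix h assume "h \<in> H"
    then obtain c where "(\<lambda>z. h z - c * u z) \<in> E"
      using span by blast
    then obtain g2 where g2: "g2 \<in> H" "\<And>x. x \<in> D \<Longrightarrow> g2 x = \<phi> x * (h x - c * u x)"
      using ext by (force simp: extends_def)
    let ?g = "\<lambda>z. c * g1 z + (mult_by w g2 z - \<alpha> * g2 z)"
    have "?g \<in> H"
      using g1(1) g2(1) by (intro add_mem diff_mem scale_mem inv)
    moreover have "extends D (\<lambda>x. \<phi> x * (w x - \<alpha>)) h ?g"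
      by (simp add: extends_def mult_by_def g1(2) g2(2) algebra_simps)
    ultimately show "\<exists>g\<in>H. extends D (\<lambda>x. \<phi> x * (w x - \<alpha>)) h g"
      by blast
  qed
qed

theorem theorem3p3:
  fixes \<Omega> :: "complex set"
    and H :: "(complex \<Rightarrow> complex) set"
    and ip :: "(complex \<Rightarrow> complex) \<Rightarrow> (complex \<Rightarrow> complex) \<Rightarrow> complex"
    and D\<^sub>\<phi> :: "complex set"
    and \<phi> :: "complex \<Rightarrow> complex"
  assumes domain: "open \<Omega>" "connected \<Omega>" "\<Omega> \<noteq> {}"
    and hilbert: "hilbert_space_of_analytic_functions \<Omega> H ip"
    and nonsingular: "nonsingular_kernel \<Omega> (reproducing_kernel H ip)"
    and M_z_invariant: "\<And>h. h \<in> H \<Longrightarrow> M_z h \<in> H"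
    and commutant: "\<And>T. bounded_operator H ip T \<Longrightarrow> (\<forall>h\<in>H. T (M_z h) = M_z (T h)) \<Longrightarrow>
      \<exists>\<theta>. multiplier H \<theta> \<and> (\<forall>h\<in>H. T h = mult_by \<theta> h)"
    and pseudomultiplier: "one_pseudomultiplier \<Omega> H ip D\<^sub>\<phi> \<phi>"
  shows "\<exists>\<alpha> \<theta>. multiplier H \<theta> \<and> (D\<^sub>\<phi> = \<Omega> \<or> D\<^sub>\<phi> = \<Omega> - {\<alpha>}) \<and>
    (\<forall>z\<in>\<Omega> - {\<alpha>}. \<phi> z = \<theta> z / (z - \<alpha>))"
proof -
  interpret hilbert_space_of_analytic_functions \<Omega> H ip
    by (rule hilbert)
  note pseudo = pseudomultiplier[unfolded one_pseudomultiplier_def]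
  have D: "set_of_uniqueness \<Omega> H D\<^sub>\<phi>"
    and sing: "\<forall>a\<in>\<Omega> - D\<^sub>\<phi>. singularity \<Omega> H D\<^sub>\<phi> \<phi> a"
    using pseudo by simp_all
  have D_sub: "D\<^sub>\<phi> \<subseteq> \<Omega>"
    using D by (simp add: set_of_uniqueness_def)
  have eqI: "f = g" if "f \<in> H" "g \<in> H" "\<And>x. x \<in> D\<^sub>\<phi> \<Longrightarrow> f x = g x" for f g
    using D that by (simp add: set_of_uniqueness_def)
  obtain E where E: "E \<subseteq> H" "codim_one H E" "\<forall>h\<in>E. \<exists>g\<in>H. extends D\<^sub>\<phi> \<phi> h g"
    using pseudo by (elim conjE exE)
  have "\<exists>\<alpha>. \<forall>h\<in>H. \<exists>g\<in>H. extends D\<^sub>\<phi> (\<lambda>x. \<phi> x * (x - \<alpha>)) h g"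
  proof (rule codim_one_shift[where w = "\<lambda>z. z"])
    show "mult_by (\<lambda>z. z) h \<in> H" if "h \<in> H" for h
      using M_z_invariant[OF that] by (simp add: M_z_def)
    show "\<exists>g\<in>H. extends D\<^sub>\<phi> \<phi> h g" if "h \<in> E" for h
      using E(3) that by (rule bspec)
  qed (fact E)+
  then obtain \<alpha> where "\<forall>h\<in>H. \<exists>g\<in>H. extends D\<^sub>\<phi> (\<lambda>x. \<phi> x * (x - \<alpha>)) h g" ..
  from bchoice[OF this[unfolded Bex_def]]
  obtain T where "\<forall>h\<in>H. T h \<in> H \<and> extends D\<^sub>\<phi> (\<lambda>x. \<phi> x * (x - \<alpha>)) h (T h)" ..
  then have T: "T h \<in> H" "extends D\<^sub>\<phi> (\<lambda>x. \<phi> x * (x - \<alpha>)) h (T h)" if "h \<in> H" for h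
    using that by simp_all
  have TD: "T h x = \<phi> x * (x - \<alpha>) * h x" if "h \<in> H" "x \<in> D\<^sub>\<phi>" for h x
    using T(2) that by (simp add: extends_def)
  have "bounded_operator H ip T"
    by (rule multiplication_on_uniqueness_set_bounded[OF D]) (fact T)+
  moreover have "\<forall>h\<in>H. T (M_z h) = M_z (T h)"
  proof
    fix h assume h: "h \<in> H"
    then show "T (M_z h) = M_z (T h)"
      by (intro eqI) (auto simp: TD T(1) M_z_invariant, simp add: M_z_def mult_by_def TD)
  qed
  ultimately have "\<exists>\<theta>. multiplier H \<theta> \<and> (\<forall>h\<in>H. T h = mult_by \<theta> h)"
    by (rule commutant)
  then obtain \<theta> where \<theta>: "multiplier H \<theta>" "\<And>h. h \<in> H \<Longrightarrow> T h = mult_by \<theta> h"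
    by blast
  have \<phi>: "\<phi> x * (x - \<alpha>) = \<theta> x" if "x \<in> D\<^sub>\<phi>" for x
  proof -
    obtain h where "h \<in> H" "h x \<noteq> 0"
      using nonsingular_kernel_nonvanishing[OF nonsingular] D_sub \<open>x \<in> D\<^sub>\<phi>\<close> by blast
    then show ?thesis
      using TD[of h x] \<theta>(2)[of h] that by (simp add: mult_by_def)
  qed
  have missing: "a = \<alpha>" if a: "a \<in> \<Omega> - D\<^sub>\<phi>" for a
  proof -
    obtain h g where h: "h \<in> H" "h a = 0" and g: "g \<in> H" "extends D\<^sub>\<phi> \<phi> h g" "g a \<noteq> 0"
      using bspec[OF sing a] by (auto simp: singularity_def)
    have "(\<lambda>z. M_z g z - \<alpha> * g z) = T h"
    proof (rule eqI)
      show "(\<lambda>z. M_z g z - \<alpha> * g z) \<in> H"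
        by (intro diff_mem scale_mem M_z_invariant g)
      show "M_z g x - \<alpha> * g x = T h x" if "x \<in> D\<^sub>\<phi>" for x
        using g(2) that h(1) by (simp add: TD extends_def M_z_def mult_by_def algebra_simps)
    qed (rule T(1)[OF h(1)])
    then have "(a - \<alpha>) * g a = \<theta> a * h a"
      using \<theta>(2)[OF h(1)] by (auto simp: M_z_def mult_by_def fun_eq_iff algebra_simps)
    then show ?thesis
      using h(2) g(3) by simp
  qed
  have "D\<^sub>\<phi> = \<Omega> \<or> D\<^sub>\<phi> = \<Omega> - {\<alpha>}"
    using missing D_sub by blast
  moreover have "\<phi> z = \<theta> z / (z - \<alpha>)" if "z \<in> \<Omega> - {\<alpha>}" for z
  proof -
    have "z \<in> D\<^sub>\<phi>"
      using missing that by blast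
    then show ?thesis
      using \<phi>[of z] that by (simp add: field_simps)
  qed
  ultimately show ?thesis
    using \<theta>(1) by blast
qed

end
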